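(* Let $G=\{1,\dots,\sqrt{n}\}\times\{1,\dots,\sqrt{n}\}$ be the integer grid of size $\sqrt{n}\times\sqrt{n}$ (with $\sqrt n$ a positive integer). For every constant $c<1$ and every integer $k$ with $3\leq k\leq c\cdot 2\sqrt{n}$, $G$ contains $\Omega\!\left(n^{\lfloor k/2\rfloor/2+1}\right)$ prime $k$-holes.
   Context: A prime segment is a segment spanned by two points of $G$ containing no point of $G$ in its relative interior. A $k$-hole of $G$ is a simple polygon with exactly $k$ vertices, all in $G$, whose interior contains no point of $G$; it is a prime $k$-hole if all of its edges are prime segments. *)

theory Defs
  imports "HOL-Analysis.Analysis"
begin

definition grid :: "nat \<Rightarrow> (real \<times> real) set" where
  "grid m = {(real i, real j) | i j. i \<in> {1..m} \<and> j \<in> {1..m}}"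

definition prime_segment :: "(real \<times> real) set \<Rightarrow> real \<times> real \<Rightarrow> real \<times> real \<Rightarrow> bool" where
  "prime_segment G a b \<longleftrightarrow> a \<in> G \<and> b \<in> G \<and> a \<noteq> b \<and> open_segment a b \<inter> G = {}"

text \<open>
  A polygon is presented by the list of its vertices in cyclic order; \<open>cyc_nth vs i\<close> is the
  vertex with index \<open>i\<close> modulo the number of vertices, so the edges are the segments from
  \<open>cyc_nth vs i\<close> to \<open>cyc_nth vs (i + 1)\<close> for \<open>i < length vs\<close>.
\<close>

definition cyc_nth :: "'a list \<Rightarrow> nat \<Rightarrow> 'a" where
  "cyc_nth vs i = vs ! (i mod length vs)"

definition polygon_edge :: "(real \<times> real) list \<Rightarrow> nat \<Rightarrow> (real \<times> real) set" where
  "polygon_edge vs i = closed_segment (cyc_nth vs i) (cyc_nth vs (i + 1))"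

definition polygon_boundary :: "(real \<times> real) list \<Rightarrow> (real \<times> real) set" where
  "polygon_boundary vs = (\<Union>i<length vs. polygon_edge vs i)"

text \<open>
  Two distinct edges meet exactly in the endpoints they share. The last clause says that every
  listed point is a genuine vertex (no angle equal to \<open>\<pi>\<close>), so that the number of vertices
  is determined by the polygon as a subset of the plane.
\<close>

definition simple_polygon :: "(real \<times> real) list \<Rightarrow> bool" where
  "simple_polygon vs \<longleftrightarrow>
     length vs \<ge> 3 \<and> distinct vs \<and>
     (\<forall>i<length vs. \<forall>j<length vs. i \<noteq> j \<longrightarrow>
        polygon_edge vs i \<inter> polygon_edge vs j =
        {cyc_nth vs i, cyc_nth vs (i + 1)} \<inter> {cyc_nth vs j, cyc_nth vs (j + 1)}) \<and>
     (\<forall>i<length vs. \<not> collinear {cyc_nth vs i, cyc_nth vs (i + 1), cyc_nth vs (i + 2)})"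

definition is_hole :: "(real \<times> real) set \<Rightarrow> nat \<Rightarrow> (real \<times> real) list \<Rightarrow> bool" where
  "is_hole G k vs \<longleftrightarrow>
     simple_polygon vs \<and> length vs = k \<and> set vs \<subseteq> G \<and> inside (polygon_boundary vs) \<inter> G = {}"

definition is_prime_hole :: "(real \<times> real) set \<Rightarrow> nat \<Rightarrow> (real \<times> real) list \<Rightarrow> bool" where
  "is_prime_hole G k vs \<longleftrightarrow>
     is_hole G k vs \<and> (\<forall>i<length vs. prime_segment G (cyc_nth vs i) (cyc_nth vs (i + 1)))"

text \<open>
  The different vertex lists of one polygon (choice of first vertex and of orientation) have the
  same boundary, so each polygon is counted once by collecting boundaries. The vertex set alone
  would not do: several simple polygons may have the same vertices.
\<close>

definition prime_holes :: "(real \<times> real) set \<Rightarrow> nat \<Rightarrow> (real \<times> real) set set" where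
  "prime_holes G k = polygon_boundary ` {vs. is_prime_hole G k vs}"

lemma finite_grid: "finite (grid m)"
proof -
  have "grid m = (\<lambda>(i, j). (real i, real j)) ` ({1..m} \<times> {1..m})"
    unfolding grid_def by auto
  then show ?thesis by simp
qed

lemma finite_prime_holes:
  assumes "finite G"
  shows "finite (prime_holes G k)"
proof -
  have "{vs. is_prime_hole G k vs} \<subseteq> {vs. set vs \<subseteq> G \<and> length vs = k}"
    unfolding is_prime_hole_def is_hole_def by auto
  then have "finite {vs. is_prime_hole G k vs}"
    using finite_lists_length_eq[OF assms] finite_subset by blast
  then show ?thesis unfolding prime_holes_def by simp
qed

end

theory Submission imports Defs begin

text \<open>
  Let \<open>r = k div 2\<close>. Choose a lattice point \<open>(x j, s + j)\<close> in each of the rows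
  \<open>s, \<dots>, s + r\<close> and join the chain of these points to its translate by one unit to
  the right; the two chains are merged to one vertex in the top row, and in the bottom row if
  \<open>k\<close> is even. Edges join adjacent rows or horizontal neighbours, hence are prime, and every
  row meets the polygon in a segment without further lattice points, hence the interior
  is empty. No angle is straight as soon as each \<open>x j\<close> avoids three values determined by
  \<open>x (j + 1)\<close> and \<open>x (j + 2)\<close>. With \<open>m = sqrt n\<close> this leaves at least
  \<open>(m - r) (m - 1)\<^sup>2 (m - 4)\<^sup>r\<^sup>-\<^sup>1\<close> polygons, where \<open>m - r \<ge> (1 - c) m\<close> and, as
  \<open>r < m\<close>, the loss from \<open>m\<close> to \<open>m - 4\<close> is at most a constant factor.
\<close>

section \<open>Collinearity and segments in coordinates\<close>

text \<open>Collinear points have difference vectors that are multiples of one vector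
  \<open>u\<close>, so the cross product of the two edges at \<open>b\<close> vanishes.\<close>

lemma not_collinear_if_det:
  fixes a b c :: "real \<times> real"
  assumes "(fst a - fst b) * (snd c - snd b) \<noteq> (fst c - fst b) * (snd a - snd b)"
  shows "\<not> collinear {a, b, c}"
proof
  assume "collinear {a, b, c}"
  then obtain u where u: "\<And>p q. p \<in> {a, b, c} \<Longrightarrow> q \<in> {a, b, c} \<Longrightarrow> \<exists>t. p - q = t *\<^sub>R u"
    unfolding collinear_def by blast
  obtain t t' where "a - b = t *\<^sub>R u" "c - b = t' *\<^sub>R u"
    using u[of a b] u[of c b] by auto
  then have "fst a - fst b = t * fst u" "snd a - snd b = t * snd u"
    "fst c - fst b = t' * fst u" "snd c - snd b = t' * snd u"
    by (metis fst_diff fst_scaleR real_scaleR_def, metis snd_diff snd_scaleR real_scaleR_def,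
        metis fst_diff fst_scaleR real_scaleR_def, metis snd_diff snd_scaleR real_scaleR_def)
  then show False
    using assms by simp
qed

text \<open>The end points differ by one in height, so \<open>snd p - h\<close> is itself the
  parameter of the segment.\<close>

lemma in_row_segment_iff:
  "p \<in> closed_segment (a, h) (b, h + 1) \<longleftrightarrow>
    h \<le> snd p \<and> snd p \<le> h + 1 \<and> fst p = a + (snd p - h) * (b - a)"
  for a b h :: real
proof
  assume "p \<in> closed_segment (a, h) (b, h + 1)"
  then obtain u where "0 \<le> u" "u \<le> 1" "p = (1 - u) *\<^sub>R (a, h) + u *\<^sub>R (b, h + 1)"
    unfolding closed_segment_def by blast
  then show "h \<le> snd p \<and> snd p \<le> h + 1 \<and> fst p = a + (snd p - h) * (b - a)"
    by (auto simp: algebra_simps)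
next
  assume p: "h \<le> snd p \<and> snd p \<le> h + 1 \<and> fst p = a + (snd p - h) * (b - a)"
  then have "p = (1 - (snd p - h)) *\<^sub>R (a, h) + (snd p - h) *\<^sub>R (b, h + 1)"
    by (auto simp: prod_eq_iff algebra_simps)
  then show "p \<in> closed_segment (a, h) (b, h + 1)"
    unfolding closed_segment_def using p by (intro CollectI exI[of _ "snd p - h"]) auto
qed

lemma in_horizontal_segment:
  fixes a b h :: real
  assumes "p \<in> closed_segment (a, h) (b, h)" "a \<le> b"
  shows "snd p = h" "a \<le> fst p" "fst p \<le> b"
proof -
  obtain u where u: "0 \<le> u" "u \<le> 1" "p = (1 - u) *\<^sub>R (a, h) + u *\<^sub>R (b, h)"
    using assms unfolding closed_segment_def by blast
  then have f: "fst p = a + u * (b - a)"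
    by (auto simp: algebra_simps)
  show "snd p = h" using u by (auto simp: algebra_simps)
  show "a \<le> fst p" using f u assms by simp
  have "u * (b - a) \<le> 1 * (b - a)" using u assms by (intro mult_right_mono) auto
  then show "fst p \<le> b" using f by simp
qed

section \<open>Points not enclosed by a set\<close>

text \<open>\<open>S\<close> lies in the component of \<open>p\<close> in the complement of
  \<open>B\<close>, which is therefore unbounded.\<close>

lemma not_inside_if_unbounded_connected:
  assumes "connected S" "p \<in> S" "S \<inter> B = {}" "\<not> bounded S"
  shows "p \<notin> inside B"
proof
  assume "p \<in> inside B"
  then have "bounded (connected_component_set (- B) p)"
    by (auto simp: inside_def)
  moreover have "S \<subseteq> connected_component_set (- B) p"
    using assms by (intro connected_component_maximal) auto
  ultimately show False
    using assms bounded_subset by blast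
qed

lemma not_inside_if_left_ray:
  fixes a b :: real
  assumes "\<And>u. u \<le> a \<Longrightarrow> (u, b) \<notin> B"
  shows "(a, b) \<notin> inside B"
proof (rule not_inside_if_unbounded_connected)
  show "connected ({..a} \<times> {b})" by (intro connected_Times) auto
  show "\<not> bounded ({..a} \<times> {b})"
  proof
    assume "bounded ({..a} \<times> {b})"
    then have "bounded (fst ` ({..a} \<times> {b}))"
      by (rule bounded_linear_image[OF _ bounded_linear_fst])
    then obtain l where "\<And>u. u \<le> a \<Longrightarrow> l \<le> u"
      using bounded_imp_bdd_below by (fastforce simp: bdd_below_def)
    from this[of "min a l - 1"] show False by linarith
  qed
qed (use assms in auto)

lemma not_inside_if_right_ray:
  fixes a b :: real
  assumes "\<And>u. a \<le> u \<Longrightarrow> (u, b) \<notin> B"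
  shows "(a, b) \<notin> inside B"
proof (rule not_inside_if_unbounded_connected)
  show "connected ({a..} \<times> {b})" by (intro connected_Times) auto
  show "\<not> bounded ({a..} \<times> {b})"
  proof
    assume "bounded ({a..} \<times> {b})"
    then have "bounded (fst ` ({a..} \<times> {b}))"
      by (rule bounded_linear_image[OF _ bounded_linear_fst])
    then obtain l where "\<And>u. a \<le> u \<Longrightarrow> u \<le> l"
      using bounded_imp_bdd_above by (fastforce simp: bdd_above_def)
    from this[of "max a l + 1"] show False by linarith
  qed
qed (use assms in auto)

section \<open>The strip polygon of a chain\<close>

text \<open>
  In \<open>bend\<close>, \<open>d = 0\<close> excludes straight angles of the left chain; \<open>d \<le> 2\<close> is needed
  for the right chain, whose end points may be left unshifted.
\<close>

locale row_strip =
  fixes s k :: nat and x :: "nat \<Rightarrow> nat"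
  assumes k3: "3 \<le> k"
    and bend: "\<And>j d. j + 2 \<le> k div 2 \<Longrightarrow> d \<le> 2 \<Longrightarrow> x j + x (j + 2) \<noteq> 2 * x (j + 1) + d"
begin

abbreviation r :: nat where "r \<equiv> k div 2"

definition y :: "nat \<Rightarrow> nat" where
  "y j = (if j = r \<or> j = 0 \<and> even k then x j else x j + 1)"

definition left :: "nat \<Rightarrow> real \<times> real" where
  "left j = (real (x j), real s + real j)"

definition right :: "nat \<Rightarrow> real \<times> real" where
  "right j = (real (y j), real s + real j)"

text \<open>The list climbs the left chain, the top vertex being entry \<open>r\<close>, and then
  descends the right chain. It ends at \<open>right 1\<close> if \<open>k\<close> is even and at
  \<open>right 0\<close> if \<open>k\<close> is odd, so the merged vertices are listed once.\<close>

definition verts :: "(real \<times> real) list" where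
  "verts = map (\<lambda>i. if i \<le> r then left i else right (2 * r - i)) [0..<k]"

lemma length_verts [simp]: "length verts = k"
  by (simp add: verts_def)

lemma r_pos: "1 \<le> r" and r_even: "even k \<Longrightarrow> 2 \<le> r"
  and k_even: "even k \<Longrightarrow> k = 2 * r" and k_odd: "odd k \<Longrightarrow> k = 2 * r + 1"
  using k3 by (auto elim!: evenE oddE)

lemma k_cases: "(even k \<and> k = 2 * r \<and> 2 \<le> r) \<or> (odd k \<and> k = 2 * r + 1 \<and> 1 \<le> r)"
  using r_pos r_even k_even k_odd by blast

lemma y_range: "x j \<le> y j" "y j \<le> x j + 1"
  by (auto simp: y_def)

text \<open>Both ends of a layer could be merged only for \<open>r = 1\<close> and even
  \<open>k\<close>, but even \<open>k\<close> forces \<open>2 \<le> r\<close>.\<close>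

lemma y_apart: "j < r \<Longrightarrow> x j < y j \<or> x (Suc j) < y (Suc j)"
  using r_even by (auto simp: y_def)

lemma y_inner: "j < r \<Longrightarrow> 0 < j \<or> odd k \<Longrightarrow> y j = x j + 1"
  by (auto simp: y_def)

lemma right_top: "right r = left r"
  by (simp add: right_def left_def y_def)

lemma right_bot: "even k \<Longrightarrow> right 0 = left 0"
  by (simp add: right_def left_def y_def)

lemma cyc_left: "i \<le> r \<Longrightarrow> cyc_nth verts i = left i"
  using k_cases by (auto simp: cyc_nth_def verts_def)

lemma cyc_wrap: "cyc_nth verts k = left 0" "cyc_nth verts (Suc k) = left 1"
  using k_cases k3 by (auto simp: cyc_nth_def verts_def mod_Suc)

text \<open>Merged vertices are covered too: level \<open>r\<close> is the last left vertex, and for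
  even \<open>k\<close> the index \<open>2 * r = k\<close> of level 0 wraps around to
  \<open>left 0\<close>.\<close>

lemma cyc_right: "j \<le> r \<Longrightarrow> cyc_nth verts (2 * r - j) = right j"
proof (cases "j = 0 \<and> even k \<or> j = r")
  case True
  then show ?thesis
    using cyc_wrap(1) k_even right_bot right_top cyc_left[of r] by (auto simp: mult_2)
next
  case False
  assume "j \<le> r"
  with False have "j < r" "0 < j \<or> odd k" by auto
  then have "2 * r - j < k" "\<not> 2 * r - j \<le> r" "2 * r - (2 * r - j) = j"
    using k_cases by linarith+
  then show ?thesis
    by (auto simp: cyc_nth_def verts_def)
qed

section \<open>Edges, their intersections and the angles\<close>

text \<open>This case rule replaces cyclic indices by layers: a left edge climbs through a layer, a
  right edge descends through one, and the horizontal bottom edge exists only for odd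
  \<open>k\<close>.\<close>

lemma edge_cases:
  assumes "i < k"
  obtains (L) "i < r" "cyc_nth verts i = left i" "cyc_nth verts (i + 1) = left (Suc i)"
  | (R) j where "j < r" "i = 2 * r - 1 - j"
      "cyc_nth verts i = right (Suc j)" "cyc_nth verts (i + 1) = right j"
  | (H) "i = 2 * r" "odd k" "cyc_nth verts i = right 0" "cyc_nth verts (i + 1) = left 0"
proof -
  consider "i < r" | "r \<le> i" "i < 2 * r" | "i = 2 * r" "odd k"
    using assms k_cases by linarith
  then show thesis
  proof cases
    case 1
    then show ?thesis using L cyc_left[of i] cyc_left[of "i + 1"] by simp
  next
    case 2
    define j where "j = 2 * r - 1 - i"
    have j: "j < r" "i = 2 * r - 1 - j" "2 * r - Suc j = i" "2 * r - j = i + 1"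
      using 2 unfolding j_def by linarith+
    have "cyc_nth verts i = right (Suc j)" "cyc_nth verts (i + 1) = right j"
      using j(1) cyc_right[of "Suc j", unfolded j(3)] cyc_right[of j, unfolded j(4)] by linarith+
    then show ?thesis
      using R[OF j(1,2)] by blast
  next
    case 3
    then show ?thesis
      using H cyc_right[of 0] cyc_wrap(1) k_odd by simp
  qed
qed

lemma in_left_edge:
  "p \<in> closed_segment (left j) (left (Suc j)) \<longleftrightarrow>
    real s + real j \<le> snd p \<and> snd p \<le> real s + real j + 1 \<and>
    fst p = real (x j) + (snd p - (real s + real j)) * (real (x (Suc j)) - real (x j))"
  using in_row_segment_iff[of p "real (x j)" "real s + real j" "real (x (Suc j))"]
  by (simp add: left_def add.assoc add.commute[of 1])

lemma in_right_edge:
  "p \<in> closed_segment (right (Suc j)) (right j) \<longleftrightarrow>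
    real s + real j \<le> snd p \<and> snd p \<le> real s + real j + 1 \<and>
    fst p = real (y j) + (snd p - (real s + real j)) * (real (y (Suc j)) - real (y j))"
  using in_row_segment_iff[of p "real (y j)" "real s + real j" "real (y (Suc j))"]
  by (simp add: right_def add.assoc add.commute[of 1] closed_segment_commute)

lemma in_bottom_edge:
  assumes "p \<in> closed_segment (right 0) (left 0)"
  shows "snd p = real s" "real (x 0) \<le> fst p" "fst p \<le> real (y 0)"
  using in_horizontal_segment[of p "real (x 0)" "real s" "real (y 0)"] assms y_range[of 0]
  by (auto simp: right_def left_def closed_segment_commute)

lemma left_edge_end:
  assumes "p \<in> closed_segment (left j) (left (Suc j))"
    and "snd p = real s + real j \<or> snd p = real s + real j + 1"
  shows "p \<in> {left j, left (Suc j)}"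
  using assms unfolding in_left_edge by (auto simp: left_def prod_eq_iff)

lemma right_edge_end:
  assumes "p \<in> closed_segment (right (Suc j)) (right j)"
    and "snd p = real s + real j \<or> snd p = real s + real j + 1"
  shows "p \<in> {right (Suc j), right j}"
  using assms unfolding in_right_edge by (auto simp: right_def prod_eq_iff)

text \<open>At relative height \<open>t\<close> the strip has width \<open>1 - t\<close> times its
  width at level \<open>j\<close> plus \<open>t\<close> times its width at level
  \<open>Suc j\<close>. Both widths are nonnegative and one is positive, so the sum vanishes only at
  \<open>t = 0\<close> or \<open>t = 1\<close>.\<close>

lemma left_right_meet:
  assumes "j < r" "p \<in> closed_segment (left j) (left (Suc j))"
    "p \<in> closed_segment (right (Suc j)) (right j)"
  shows "snd p = real s + real j \<or> snd p = real s + real j + 1"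
proof -
  define t where "t = snd p - (real s + real j)"
  have t: "0 \<le> t" "t \<le> 1"
    and eq: "real (x j) + t * (real (x (Suc j)) - real (x j)) =
      real (y j) + t * (real (y (Suc j)) - real (y j))"
    using assms unfolding in_left_edge in_right_edge t_def by auto
  have eq': "(1 - t) * (real (y j) - real (x j)) + t * (real (y (Suc j)) - real (x (Suc j))) = 0"
    using eq by (simp add: algebra_simps)
  have nn: "0 \<le> (1 - t) * (real (y j) - real (x j))"
    "0 \<le> t * (real (y (Suc j)) - real (x (Suc j)))"
    using t y_range by auto
  have "(1 - t) * (real (y j) - real (x j)) = 0"
    "t * (real (y (Suc j)) - real (x (Suc j))) = 0"
    using eq' nn by linarith+
  then have "t = 0 \<or> t = 1"
    using y_apart[OF assms(1)] by auto
  then show ?thesis by (auto simp: t_def)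
qed

lemma layers_meet:
  fixes h h' :: nat and z :: real
  assumes "h \<noteq> h'" "real s + real h \<le> z" "z \<le> real s + real h + 1"
    "real s + real h' \<le> z" "z \<le> real s + real h' + 1"
  shows "z = real s + real h \<or> z = real s + real h + 1"
  using assms by linarith

text \<open>A common point of two edges lies on a lattice row, and a slanted edge reaches such rows
  only in its ends. If edge \<open>i\<close> is the horizontal one, the same is applied to edge
  \<open>j\<close>. Only the ends of edge \<open>i\<close> are named; exchanging \<open>i\<close>
  and \<open>j\<close> gives the rest.\<close>

lemma edges_meet_in_end:
  assumes "i < k" "j < k" "i \<noteq> j" "p \<in> polygon_edge verts i" "p \<in> polygon_edge verts j"
  shows "p \<in> {cyc_nth verts i, cyc_nth verts (i + 1)}"
  using assms(1)
proof (cases rule: edge_cases)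
  case L
  have pi: "p \<in> closed_segment (left i) (left (Suc i))"
    using assms(4) L by (simp add: polygon_edge_def)
  have "snd p = real s + real i \<or> snd p = real s + real i + 1"
    using assms(2)
  proof (cases rule: edge_cases)
    case L
    then have "p \<in> closed_segment (left j) (left (Suc j))"
      using assms(5) by (simp add: polygon_edge_def)
    then show ?thesis
      using pi layers_meet[OF assms(3)] unfolding in_left_edge by blast
  next
    case (R j')
    then have pj: "p \<in> closed_segment (right (Suc j')) (right j')"
      using assms(5) by (simp add: polygon_edge_def)
    show ?thesis
    proof (cases "j' = i")
      case True
      then show ?thesis using left_right_meet pi pj R(1) by blast
    next
      case False
      then show ?thesis
        using pi pj layers_meet[of i j' "snd p"] unfolding in_left_edge in_right_edge by auto
    qed
  next
    case H
    then have "p \<in> closed_segment (right 0) (left 0)"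
      using assms(5) by (simp add: polygon_edge_def)
    then show ?thesis
      using in_bottom_edge(1)[of p] pi unfolding in_left_edge by linarith
  qed
  then show ?thesis
    using left_edge_end[OF pi] L by simp
next
  case (R i')
  have pi: "p \<in> closed_segment (right (Suc i')) (right i')"
    using assms(4) R by (simp add: polygon_edge_def)
  have "snd p = real s + real i' \<or> snd p = real s + real i' + 1"
    using assms(2)
  proof (cases rule: edge_cases)
    case L
    then have pj: "p \<in> closed_segment (left j) (left (Suc j))"
      using assms(5) by (simp add: polygon_edge_def)
    show ?thesis
    proof (cases "j = i'")
      case True
      then show ?thesis using left_right_meet pi pj L(1) by blast
    next
      case False
      then show ?thesis
        using pi pj layers_meet[of i' j "snd p"] unfolding in_left_edge in_right_edge by auto
    qed
  next
    case (R j')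
    then have "p \<in> closed_segment (right (Suc j')) (right j')" "i' \<noteq> j'"
      using assms(3,5) \<open>i = 2 * r - 1 - i'\<close> by (auto simp: polygon_edge_def)
    then show ?thesis
      using pi layers_meet[of i' j' "snd p"] unfolding in_right_edge by blast
  next
    case H
    then have "p \<in> closed_segment (right 0) (left 0)"
      using assms(5) by (simp add: polygon_edge_def)
    then show ?thesis
      using in_bottom_edge(1)[of p] pi unfolding in_right_edge by linarith
  qed
  then show ?thesis
    using right_edge_end[OF pi] R by simp
next
  case H
  have "p \<in> closed_segment (right 0) (left 0)"
    using assms(4) H by (simp add: polygon_edge_def)
  then have sp: "snd p = real s" by (rule in_bottom_edge)
  have "p \<in> {right 0, left 0}"
    using assms(2)
  proof (cases rule: edge_cases)
    case L
    then have "p \<in> closed_segment (left j) (left (Suc j))"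
      using assms(5) by (simp add: polygon_edge_def)
    then show ?thesis
      using sp unfolding in_left_edge by (auto simp: left_def prod_eq_iff)
  next
    case (R j')
    then have "p \<in> closed_segment (right (Suc j')) (right j')"
      using assms(5) by (simp add: polygon_edge_def)
    then show ?thesis
      using sp unfolding in_right_edge by (auto simp: right_def prod_eq_iff)
  next
    case H
    then show ?thesis using assms(3) \<open>i = 2 * r\<close> by simp
  qed
  then show ?thesis using H by simp
qed

lemma edges_meet:
  assumes "i < k" "j < k" "i \<noteq> j"
  shows "polygon_edge verts i \<inter> polygon_edge verts j =
    {cyc_nth verts i, cyc_nth verts (i + 1)} \<inter> {cyc_nth verts j, cyc_nth verts (j + 1)}"
proof
  show "polygon_edge verts i \<inter> polygon_edge verts j \<subseteq>
    {cyc_nth verts i, cyc_nth verts (i + 1)} \<inter> {cyc_nth verts j, cyc_nth verts (j + 1)}"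
    using edges_meet_in_end[of i j] edges_meet_in_end[of j i] assms by blast
qed (auto simp: polygon_edge_def)

lemma left_bend:
  assumes "j + 2 \<le> r"
  shows "\<not> collinear {left j, left (j + 1), left (j + 2)}"
  using bend[OF assms, of 0]
  by (intro not_collinear_if_det) (auto simp: left_def)

text \<open>The middle vertex is always shifted by one, the outer ones by \<open>e\<close> and
  \<open>e'\<close> in \<open>{0, 1}\<close>. A straight angle would thus be an equality excluded by
  \<open>bend\<close> with \<open>d = 2 - (e + e')\<close>.\<close>

lemma right_bend:
  assumes "j + 2 \<le> r"
  shows "\<not> collinear {right (j + 2), right (j + 1), right j}"
proof -
  define e where "e = y j - x j"
  define e' where "e' = y (j + 2) - x (j + 2)"
  have e: "e \<le> 1" "e' \<le> 1" "y j = x j + e" "y (j + 2) = x (j + 2) + e'"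
    using y_range by (auto simp: e_def e'_def le_diff_conv)
  moreover have "y (j + 1) = x (j + 1) + 1"
    using assms by (intro y_inner) auto
  ultimately have "y j + y (j + 2) \<noteq> 2 * y (j + 1)"
    using bend[OF assms, of "2 - (e + e')"] by auto
  then show ?thesis
    by (intro not_collinear_if_det) (auto simp: right_def)
qed

lemma no_straight_angle:
  assumes "i < k"
  shows "\<not> collinear {cyc_nth verts i, cyc_nth verts (i + 1), cyc_nth verts (i + 2)}"
proof -
  \<comment> \<open>The middle vertex \<open>i + 1\<close> is, in this order: inside the left chain,
    the top, inside the right chain, the right bottom corner, the merged bottom vertex, the left
    bottom corner.\<close>
  consider "i + 2 \<le> r" | "i + 1 = r" | "r \<le> i" "i + 2 \<le> 2 * r"
    | "i + 1 = 2 * r" "odd k" | "i + 1 = 2 * r" "even k" | "i = 2 * r" "odd k"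
    using assms k_cases by linarith
  then show ?thesis
  proof cases
    case 1
    then show ?thesis using left_bend[of i] cyc_left[of i] cyc_left[of "i + 1"] cyc_left[of "i + 2"]
      by simp
  next
    case 2
    then have "i + 2 = 2 * r - i" by simp
    then have c: "cyc_nth verts i = left i" "cyc_nth verts (i + 1) = left (i + 1)"
      "cyc_nth verts (i + 2) = right i"
      using cyc_left[of i] cyc_left[of "i + 1"] cyc_right[of i] 2 by auto
    \<comment> \<open>For even \<open>k\<close> the level below the top is not the merged bottom
      level, because \<open>2 \<le> r\<close>.\<close>
    have "y i = x i + 1"
      using 2 r_even by (intro y_inner) auto
    then show ?thesis
      unfolding c by (intro not_collinear_if_det) (auto simp: left_def right_def)
  next
    case 3
    define j where "j = 2 * r - (i + 2)"
    have j: "j + 2 \<le> r" "i = 2 * r - (j + 2)" "i + 1 = 2 * r - (j + 1)" "i + 2 = 2 * r - j"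
      using 3 by (auto simp: j_def)
    have "cyc_nth verts i = right (j + 2)" "cyc_nth verts (i + 1) = right (j + 1)"
      "cyc_nth verts (i + 2) = right j"
      using j(1) cyc_right[of "j + 2", folded j(2)] cyc_right[of "j + 1", folded j(3)]
        cyc_right[of j, folded j(4)] by auto
    then show ?thesis using right_bend[OF j(1)] by simp
  next
    case 4
    \<comment> \<open>The form \<open>2 * r - 0\<close> lets \<open>cyc_right\<close> at level 0 be
      folded into the index \<open>i + 1\<close>.\<close>
    have i: "i = 2 * r - 1" "i + 1 = 2 * r - 0" "i + 2 = k"
      using 4 k_odd by auto
    have c: "cyc_nth verts i = right 1" "cyc_nth verts (i + 1) = right 0"
      "cyc_nth verts (i + 2) = left 0"
      unfolding i(3) using r_pos cyc_right[of 1, folded i(1)] cyc_right[of 0, folded i(2)] cyc_wrap(1)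
      by auto
    have "y 0 = x 0 + 1"
      using 4 r_pos by (intro y_inner) auto
    then show ?thesis
      unfolding c by (intro not_collinear_if_det) (auto simp: left_def right_def)
  next
    case 5
    have i: "i = 2 * r - 1" "i + 1 = k" "i + 2 = Suc k"
      using 5 k_even by auto
    have c: "cyc_nth verts i = right 1" "cyc_nth verts (i + 1) = left 0"
      "cyc_nth verts (i + 2) = left 1"
      unfolding i(2,3) using r_pos cyc_right[of 1, folded i(1)] cyc_wrap by auto
    have "y 1 = x 1 + 1"
      using 5 r_even by (intro y_inner) auto
    then show ?thesis
      unfolding c by (intro not_collinear_if_det) (auto simp: left_def right_def)
  next
    case 6
    have i: "i = 2 * r - 0" "i + 1 = k" "i + 2 = Suc k"
      using 6 k_odd by auto
    have c: "cyc_nth verts i = right 0" "cyc_nth verts (i + 1) = left 0"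
      "cyc_nth verts (i + 2) = left 1"
      unfolding i(2,3) using cyc_right[of 0, folded i(1)] cyc_wrap by auto
    have "y 0 = x 0 + 1"
      using 6 r_pos by (intro y_inner) auto
    then show ?thesis
      unfolding c by (intro not_collinear_if_det) (auto simp: left_def right_def)
  qed
qed

text \<open>Vertices of one chain differ in height. Entries beyond index \<open>r\<close> are
  unmerged right vertices, hence lie one unit to the right of the left vertex of their row.\<close>

lemma distinct_verts: "distinct verts"
proof -
  have "inj_on (\<lambda>i. if i \<le> r then left i else right (2 * r - i)) {0..<k}"
  proof (rule inj_onI)
    fix i j
    assume ij: "i \<in> {0..<k}" "j \<in> {0..<k}"
      and eq: "(if i \<le> r then left i else right (2 * r - i)) =
        (if j \<le> r then left j else right (2 * r - j))"
    have apart: "left a \<noteq> right (2 * r - b)" if "r < b" "b < k" for a b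
    proof -
      have "y (2 * r - b) = x (2 * r - b) + 1"
        using that k_cases by (intro y_inner) auto
      then show ?thesis by (auto simp: left_def right_def)
    qed
    have inj: "left a = left b \<Longrightarrow> a = b" "right a = right b \<Longrightarrow> a = b" for a b
      by (auto simp: left_def right_def)
    show "i = j"
      using eq apart[of i j] apart[of j i] inj(1)[of i j] inj(2)[of "2 * r - i" "2 * r - j"] ij k_cases
      by (auto split: if_splits)
  qed
  then show ?thesis by (simp add: verts_def distinct_map)
qed

lemma simple_polygon_verts: "simple_polygon verts"
  using k3 distinct_verts edges_meet no_straight_angle by (simp add: simple_polygon_def)

section \<open>Lattice rows, empty interior and primality\<close>

text \<open>In a lattice row the boundary stays between two equal or neighbouring columns. This
  yields both the empty interior and the recovery of the chain from the polygon.\<close>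

lemma boundary_row:
  assumes "p \<in> polygon_boundary verts"
  shows "real s \<le> snd p" "snd p \<le> real s + real r"
    and "snd p = real s + real j \<Longrightarrow> real (x j) \<le> fst p \<and> fst p \<le> real (y j)"
proof -
  obtain i where i: "i < k" "p \<in> polygon_edge verts i"
    using assms by (auto simp: polygon_boundary_def)
  have "real s \<le> snd p \<and> snd p \<le> real s + real r \<and>
    (snd p = real s + real j \<longrightarrow> real (x j) \<le> fst p \<and> fst p \<le> real (y j))"
    using i(1)
  proof (cases rule: edge_cases)
    case L
    then have p: "p \<in> closed_segment (left i) (left (Suc i))"
      using i(2) by (simp add: polygon_edge_def)
    then have "real s + real i \<le> snd p" "snd p \<le> real s + real i + 1"
      unfolding in_left_edge by auto
    moreover have "fst p = real (x j)" if "snd p = real s + real j"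
    proof -
      have "j = i \<or> j = Suc i" using that calculation by linarith
      then show ?thesis using p that unfolding in_left_edge by auto
    qed
    ultimately show ?thesis using L(1) y_range[of j] by auto
  next
    case (R h)
    then have p: "p \<in> closed_segment (right (Suc h)) (right h)"
      using i(2) by (simp add: polygon_edge_def)
    then have "real s + real h \<le> snd p" "snd p \<le> real s + real h + 1"
      unfolding in_right_edge by auto
    moreover have "fst p = real (y j)" if "snd p = real s + real j"
    proof -
      have "j = h \<or> j = Suc h" using that calculation by linarith
      then show ?thesis using p that unfolding in_right_edge by auto
    qed
    ultimately show ?thesis using R(1) y_range[of j] by auto
  next
    case H
    then have "p \<in> closed_segment (right 0) (left 0)"
      using i(2) by (simp add: polygon_edge_def)
    then show ?thesis
      using in_bottom_edge by auto
  qed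
  then show "real s \<le> snd p" "snd p \<le> real s + real r"
    "snd p = real s + real j \<Longrightarrow> real (x j) \<le> fst p \<and> fst p \<le> real (y j)"
    by auto
qed

lemma cyc_in_boundary: "cyc_nth verts i \<in> polygon_boundary verts"
proof -
  have "i mod k < k" using k3 by simp
  moreover have "cyc_nth verts i \<in> polygon_edge verts (i mod k)"
    by (simp add: polygon_edge_def cyc_nth_def)
  ultimately show ?thesis by (auto simp: polygon_boundary_def)
qed

lemma left_in_boundary: "j \<le> r \<Longrightarrow> left j \<in> polygon_boundary verts"
  using cyc_in_boundary[of j] cyc_left[of j] by simp

lemma right_in_boundary: "j \<le> r \<Longrightarrow> right j \<in> polygon_boundary verts"
  using cyc_in_boundary[of "2 * r - j"] cyc_right[of j] by simp

text \<open>No integer lies strictly between \<open>x j\<close> and \<open>y j\<close>, so a lattice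
  point off the boundary can escape along its row, to the left or to the right.\<close>

lemma inside_no_lattice_points: "(real a, real b) \<notin> inside (polygon_boundary verts)"
proof (cases "(real a, real b) \<in> polygon_boundary verts")
  case True
  then show ?thesis by (simp add: inside_def)
next
  case False
  show ?thesis
  proof (cases "s \<le> b \<and> b \<le> s + r")
    case True
    define j where "j = b - s"
    have j: "b = s + j" "j \<le> r" using True by (auto simp: j_def)
    have "a \<noteq> x j" "a \<noteq> y j"
      using False left_in_boundary[OF j(2)] right_in_boundary[OF j(2)] j(1)
      by (auto simp: left_def right_def)
    then consider "a < x j" | "y j < a"
      using y_range[of j] by linarith
    then show ?thesis
    proof cases
      case 1
      show ?thesis
        using 1 boundary_row(3)[of _ j] j(1)
        by (intro not_inside_if_left_ray) fastforce
    next
      case 2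
      show ?thesis
        using 2 boundary_row(3)[of _ j] j(1)
        by (intro not_inside_if_right_ray) fastforce
    qed
  next
    case False
    then show ?thesis
      using boundary_row(1,2) by (intro not_inside_if_left_ray) fastforce
  qed
qed

text \<open>Lattice points on a slanted edge have integer height and so are its ends; the bottom
  edge has length one. The strict bound \<open>x j < m\<close> leaves room for the shifted
  column.\<close>

lemma prime_hole_verts:
  assumes "1 \<le> s" "s + r \<le> m" "\<And>j. j \<le> r \<Longrightarrow> 1 \<le> x j \<and> x j < m"
  shows "is_prime_hole (grid m) k verts"
proof -
  have left_grid: "left j \<in> grid m" if "j \<le> r" for j
    using assms(1,2) assms(3)[OF that] that unfolding grid_def left_def
    by (auto intro!: exI[of _ "x j"] exI[of _ "s + j"])
  have right_grid: "right j \<in> grid m" if "j \<le> r" for j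
    using assms(1,2) assms(3)[OF that] that y_range[of j] unfolding grid_def right_def
    by (auto intro!: exI[of _ "y j"] exI[of _ "s + j"])
  have vg: "set verts \<subseteq> grid m"
    using left_grid right_grid by (auto simp: verts_def)
  have "inside (polygon_boundary verts) \<inter> grid m = {}"
    using inside_no_lattice_points unfolding grid_def by auto
  moreover have "prime_segment (grid m) (cyc_nth verts i) (cyc_nth verts (i + 1))" if "i < k" for i
  proof -
    have cg: "cyc_nth verts j \<in> grid m" for j
      using vg k3 by (auto simp: cyc_nth_def intro!: subsetD[OF vg] nth_mem)
    have no_pt: "p \<in> {cyc_nth verts i, cyc_nth verts (i + 1)}"
      if seg: "p \<in> polygon_edge verts i" and grid: "p \<in> grid m" for p
    proof -
      obtain a b :: nat where ab: "p = (real a, real b)" using grid by (auto simp: grid_def)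
      from \<open>i < k\<close> show ?thesis
      proof (cases rule: edge_cases)
        case L
        then have p: "p \<in> closed_segment (left i) (left (Suc i))"
          using seg by (simp add: polygon_edge_def)
        then have "b = s + i \<or> b = s + i + 1"
          unfolding in_left_edge ab by (simp, linarith)
        then show ?thesis using left_edge_end[OF p] L ab by auto
      next
        case (R h)
        then have p: "p \<in> closed_segment (right (Suc h)) (right h)"
          using seg by (simp add: polygon_edge_def)
        then have "b = s + h \<or> b = s + h + 1"
          unfolding in_right_edge ab by (simp, linarith)
        then show ?thesis using right_edge_end[OF p] R ab by auto
      next
        case H
        then have "p \<in> closed_segment (right 0) (left 0)"
          using seg by (simp add: polygon_edge_def)
        then have "b = s" "x 0 \<le> a" "a \<le> y 0"
          using in_bottom_edge[of p] ab by auto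
        then have "p = left 0 \<or> p = right 0"
          using y_range[of 0] ab by (auto simp: left_def right_def)
        then show ?thesis using H by auto
      qed
    qed
    \<comment> \<open>If two of the three vertices coincided, the triple would be collinear.\<close>
    have "cyc_nth verts i \<noteq> cyc_nth verts (i + 1)"
      using no_straight_angle[OF that] by (auto simp: collinear_2)
    then show ?thesis
      unfolding prime_segment_def using cg no_pt
      by (auto simp: polygon_edge_def open_segment_def)
  qed
  ultimately show ?thesis
    using simple_polygon_verts vg by (simp add: is_prime_hole_def is_hole_def)
qed

end

section \<open>Counting the strip polygons\<close>

text \<open>The boundary determines \<open>s\<close> as its lowest height and \<open>x j\<close> as
  its leftmost abscissa in row \<open>s + j\<close>. Using this in both directions turns the
  inequalities into equalities.\<close>

lemma row_strip_boundary_le: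
  assumes "row_strip k x" "row_strip k x'"
    and eq: "polygon_boundary (row_strip.verts s k x) = polygon_boundary (row_strip.verts s' k x')"
  shows "s' \<le> s" and "s = s' \<Longrightarrow> j \<le> k div 2 \<Longrightarrow> x' j \<le> x j"
proof -
  interpret A: row_strip s k x by fact
  interpret B: row_strip s' k x' by fact
  show "s' \<le> s"
    using B.boundary_row(1)[of "A.left 0"] A.left_in_boundary[of 0] eq by (simp add: A.left_def)
  show "x' j \<le> x j" if "s = s'" "j \<le> k div 2"
  proof -
    have "(real (x j), real s + real j) \<in> polygon_boundary B.verts"
      using A.left_in_boundary[OF that(2)] unfolding A.left_def eq .
    from B.boundary_row(3)[OF this, of j] that(1) show ?thesis by simp
  qed
qed

text \<open>Entries are the columns from the bottom row upwards. Lists grow at the front, where a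
  new entry is restricted only by the two following it; \<open>n\<close> counts the restricted
  entries.\<close>

fun bent_lists :: "nat \<Rightarrow> nat \<Rightarrow> nat list set" where
  "bent_lists M 0 = {[a, b] | a b. a \<in> {1..M} \<and> b \<in> {1..M}}"
| "bent_lists M (Suc n) = {a # w | a w. w \<in> bent_lists M n \<and> a \<in> {1..M} \<and>
     (\<forall>d\<le>2. a + w ! 1 \<noteq> 2 * w ! 0 + d)}"

lemma bent_lists_props:
  assumes "w \<in> bent_lists M n"
  shows "length w = n + 2 \<and> set w \<subseteq> {1..M} \<and>
    (\<forall>j d. j + 2 < n + 2 \<longrightarrow> d \<le> 2 \<longrightarrow> w ! j + w ! (j + 2) \<noteq> 2 * w ! (j + 1) + d)"
  using assms
proof (induction n arbitrary: w)
  case 0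
  then show ?case by auto
next
  case (Suc n)
  then obtain a v where w: "w = a # v" "v \<in> bent_lists M n" "a \<in> {1..M}"
    "\<And>d. d \<le> 2 \<Longrightarrow> a + v ! 1 \<noteq> 2 * v ! 0 + d" by auto
  have "w ! j + w ! (j + 2) \<noteq> 2 * w ! (j + 1) + d" if "j + 2 < Suc n + 2" "d \<le> 2" for j d
  proof (cases j)
    case 0
    then show ?thesis using w(1) w(4)[OF that(2)] by simp
  next
    case (Suc i)
    then show ?thesis using Suc.IH[OF w(2)] that w(1) by auto
  qed
  then show ?case using Suc.IH[OF w(2)] w by auto
qed

lemma finite_bent_lists: "finite (bent_lists M n)"
proof (rule finite_subset)
  show "bent_lists M n \<subseteq> {w. set w \<subseteq> {1..M} \<and> length w = n + 2}"
    using bent_lists_props by blast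
qed (rule finite_lists_length_eq, simp)

text \<open>The first two entries are free, and each extension loses at most three of the
  \<open>M\<close> values.\<close>

lemma card_bent_lists: "M\<^sup>2 * (M - 3) ^ n \<le> card (bent_lists M n)"
proof (induction n)
  case 0
  have "bent_lists M 0 = (\<lambda>(a, b). [a, b]) ` ({1..M} \<times> {1..M})" by auto
  moreover have "inj_on (\<lambda>(a, b). [a, b]) ({1..M} \<times> {1..M})" by (auto simp: inj_on_def)
  ultimately show ?case by (simp add: card_image power2_eq_square)
next
  case (Suc n)
  define A where "A w = {a \<in> {1..M}. \<forall>d\<le>2. a + w ! 1 \<noteq> 2 * w ! 0 + d}" for w :: "nat list"
  have A: "M - 3 \<le> card (A w)" for w
  proof -
    \<comment> \<open>Truncated subtraction is harmless: every forbidden \<open>a\<close> equals one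
      of these three differences, and truncation can only contribute 0.\<close>
    let ?F = "(\<lambda>d. 2 * w ! 0 + d - w ! 1) ` {..2}"
    have "{1..M} - ?F \<subseteq> A w"
      unfolding A_def by (auto simp: image_iff) (metis add_diff_cancel_right' atMost_iff)
    then have "card ({1..M} - ?F) \<le> card (A w)"
      by (intro card_mono) (auto simp: A_def)
    moreover have "card {1..M} - card ?F \<le> card ({1..M} - ?F)"
      by (intro diff_card_le_card_Diff) auto
    moreover have "card ?F \<le> 3"
      using card_image_le[of "{..2::nat}" "\<lambda>d. 2 * w ! 0 + d - w ! 1"] by simp
    ultimately show ?thesis by simp
  qed
  have "bent_lists M (Suc n) = (\<lambda>(w, a). a # w) ` (SIGMA w : bent_lists M n. A w)"
    by (auto simp: A_def)
  moreover have "inj_on (\<lambda>(w, a). a # w) (SIGMA w : bent_lists M n. A w)"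
    by (auto simp: inj_on_def)
  ultimately have "card (bent_lists M (Suc n)) = (\<Sum>w\<in>bent_lists M n. card (A w))"
    using finite_bent_lists by (simp add: card_image A_def)
  also have "\<dots> \<ge> (\<Sum>w\<in>bent_lists M n. M - 3)"
    using A by (intro sum_mono) auto
  finally have "card (bent_lists M n) * (M - 3) \<le> card (bent_lists M (Suc n))"
    by simp
  moreover have "M\<^sup>2 * (M - 3) ^ n * (M - 3) \<le> card (bent_lists M n) * (M - 3)"
    using Suc by (intro mult_right_mono) auto
  moreover have "M\<^sup>2 * (M - 3) ^ Suc n = M\<^sup>2 * (M - 3) ^ n * (M - 3)"
    by (simp add: mult_ac)
  ultimately show ?case by (metis order.trans)
qed

text \<open>There are \<open>m - k div 2\<close> bottom rows. Columns range up to
  \<open>m - 1\<close> so that shifted vertices stay in the grid, hence \<open>m - 4\<close> choices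
  for each restricted column.\<close>

lemma card_prime_holes_ge:
  assumes "3 \<le> k"
  shows "(m - k div 2) * ((m - 1)\<^sup>2 * (m - 4) ^ (k div 2 - 1)) \<le> card (prime_holes (grid m) k)"
proof -
  let ?r = "k div 2"
  let ?W = "bent_lists (m - 1) (?r - 1)"
  let ?P = "\<lambda>(s, w). polygon_boundary (row_strip.verts s k ((!) w))"
  \<comment> \<open>With parameter \<open>?r - 1\<close> the lists have one entry for each of the
    levels \<open>0\<close> to \<open>?r\<close>.\<close>
  have r: "?r - 1 + 2 = ?r + 1" using assms by linarith
  have strip: "row_strip k ((!) w)" if "w \<in> ?W" for w
    using bent_lists_props[OF that] assms r by unfold_locales auto
  have hole: "?P (s, w) \<in> prime_holes (grid m) k" if "s \<in> {1..m - ?r}" "w \<in> ?W" for s w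
  proof -
    have "is_prime_hole (grid m) k (row_strip.verts s k ((!) w))"
    proof (rule row_strip.prime_hole_verts[OF strip[OF that(2)]])
      show "1 \<le> s" "s + ?r \<le> m" using that(1) by auto
      show "1 \<le> w ! j \<and> w ! j < m" if "j \<le> ?r" for j
      proof -
        have "j < length w" "set w \<subseteq> {1..m - 1}"
          using bent_lists_props[OF \<open>w \<in> ?W\<close>] r that by auto
        then have "w ! j \<in> {1..m - 1}"
          by (meson nth_mem subsetD)
        then show ?thesis by auto
      qed
    qed
    then show ?thesis by (auto simp: prime_holes_def)
  qed
  have inj: "inj_on ?P ({1..m - ?r} \<times> ?W)"
  proof (rule inj_onI, clarify)
    fix s w s' w'
    assume w: "w \<in> ?W" "w' \<in> ?W"
      and eq: "polygon_boundary (row_strip.verts s k ((!) w)) =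
        polygon_boundary (row_strip.verts s' k ((!) w'))"
    note le = row_strip_boundary_le[OF strip[OF w(1)] strip[OF w(2)] eq]
      row_strip_boundary_le[OF strip[OF w(2)] strip[OF w(1)] eq[symmetric]]
    have s: "s = s'" using le(1,3) by simp
    have "w = w'"
    proof (rule nth_equalityI)
      show "length w = length w'" using bent_lists_props w by metis
      fix j assume "j < length w"
      then have "j \<le> ?r" using bent_lists_props[OF w(1)] r by simp
      then show "w ! j = w' ! j" using le(2,4) s by (simp add: order_antisym)
    qed
    then show "s = s' \<and> w = w'" using s by simp
  qed
  have "(m - ?r) * ((m - 1)\<^sup>2 * (m - 4) ^ (?r - 1)) \<le> (m - ?r) * card ?W"
    using card_bent_lists[of "m - 1" "?r - 1"] by (intro mult_left_mono) auto
  also have "\<dots> = card (?P ` ({1..m - ?r} \<times> ?W))"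
    using inj by (simp add: card_image card_cartesian_product)
  also have "\<dots> \<le> card (prime_holes (grid m) k)"
    using hole by (intro card_mono finite_prime_holes finite_grid) auto
  finally show ?thesis .
qed

section \<open>The asymptotic bound\<close>

text \<open>For these \<open>t\<close> the product \<open>(1 - t) * (1 + 2 * t)\<close> is at least
  1, and \<open>1 + 2 * t\<close> is at most \<open>exp (2 * t)\<close>. With
  \<open>t = 4 / m\<close> this bounds the \<open>m\<close>-th power of \<open>1 - t\<close> below
  by \<open>exp (- 8)\<close>.\<close>

lemma exp_minus_double_le:
  fixes t :: real
  assumes "0 \<le> t" "t \<le> 1 / 2"
  shows "exp (- (2 * t)) \<le> 1 - t"
proof -
  have "1 \<le> (1 - t) * (1 + 2 * t)"
    using mult_left_mono[OF assms(2,1)] by (simp add: algebra_simps)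
  also have "\<dots> \<le> (1 - t) * exp (2 * t)"
    using assms by (intro mult_left_mono exp_ge_add_one_self) auto
  finally show ?thesis
    by (simp add: exp_minus divide_simps)
qed

theorem theorem7:
  fixes c :: real
  assumes "c < 1"
  shows "\<exists>C>0. \<forall>\<^sub>F n in sequentially. \<forall>m k :: nat.
           0 < m \<and> n = m ^ 2 \<and> 3 \<le> k \<and> real k \<le> c * (2 * sqrt (real n)) \<longrightarrow>
           real (card (prime_holes (grid m) k)) \<ge> C * real n powr (real (k div 2) / 2 + 1)"
\<comment> \<open>The factor \<open>1 - c\<close> comes from the choice of the bottom row,
  \<open>exp (- 8)\<close> from replacing \<open>m\<close> by \<open>m - 4\<close> in
  \<open>r + 1\<close> factors.\<close>
proof (intro exI[of _ "(1 - c) * exp (- 8)"] conjI)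
  show "0 < (1 - c) * exp (- 8)" using assms by simp
  have main: "(1 - c) * exp (- 8) * real n powr (real (k div 2) / 2 + 1)
      \<le> real (card (prime_holes (grid m) k))"
    if n: "64 \<le> n" and mk: "0 < m" "n = m\<^sup>2" "3 \<le> k" "real k \<le> c * (2 * sqrt (real n))" for n m k
  proof -
    define r where "r = k div 2"
    \<comment> \<open>The threshold 64 gives \<open>8 \<le> m\<close>, which is what
      \<open>4 / m \<le> 1 / 2\<close> requires.\<close>
    have "8\<^sup>2 \<le> m\<^sup>2" using n mk(2) by simp
    then have m: "8 \<le> m" using power2_le_imp_le[of 8 m] by simp
    have "2 * real r \<le> real k" unfolding r_def by linarith
    then have rc: "real r \<le> c * real m" using mk by simp
    also have "\<dots> < real m" using assms mk(1) by simp
    finally have rm: "r < m" by simp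
    have r1: "1 \<le> r" using mk(3) unfolding r_def by linarith
    define t where "t = 4 / real m"
    have t: "0 \<le> t" "t \<le> 1 / 2" using m by (auto simp: t_def divide_simps)
    have m4: "real (m - 4) = real m * (1 - t)" using m by (simp add: t_def field_simps)
    have "real n powr (real r / 2 + 1) = (real m powr 2) powr (real r / 2 + 1)"
      using mk by simp
    also have "\<dots> = real m powr real (r + 2)"
      unfolding powr_powr by (simp add: algebra_simps)
    also have "\<dots> = real m ^ (r + 2)"
      using mk(1) by (intro powr_realpow) simp
    finally have pow: "real n powr (real r / 2 + 1) = real m ^ (r + 2)" .
    have "exp (- 8) = exp (- (2 * t)) ^ m"
      using mk(1) by (simp add: exp_of_nat_mult[symmetric] t_def)
    also have "\<dots> \<le> (1 - t) ^ m"
      using exp_minus_double_le[OF t] by (intro power_mono) auto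
    also have "\<dots> \<le> (1 - t) ^ (r + 1)"
      using rm t by (intro power_decreasing) auto
    finally have e: "exp (- 8) \<le> (1 - t) ^ (r + 1)" .
    have "(1 - c) * exp (- 8) * real m ^ (r + 2) = ((1 - c) * real m) * (exp (- 8) * real m ^ (r + 1))"
      by simp
    also have "\<dots> \<le> real (m - r) * ((1 - t) ^ (r + 1) * real m ^ (r + 1))"
      using e rc rm assms by (intro mult_mono mult_right_mono) (auto simp: algebra_simps of_nat_diff)
    also have "(1 - t) ^ (r + 1) * real m ^ (r + 1) = real (m - 4) ^ (r + 1)"
      unfolding m4 by (simp add: power_mult_distrib mult_ac)
    also have "real (m - 4) ^ (r + 1) = real (m - 4) ^ 2 * real (m - 4) ^ (r - 1)"
      using r1 by (simp add: power_add[symmetric])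
    \<comment> \<open>Two of the factors \<open>m - 4\<close> are enlarged to \<open>m - 1\<close>,
      the number of choices for each free column.\<close>
    also have "real (m - r) * \<dots> \<le> real (m - r) * (real (m - 1) ^ 2 * real (m - 4) ^ (r - 1))"
      by (intro mult_left_mono mult_right_mono power_mono) auto
    also have "\<dots> = real ((m - r) * ((m - 1)\<^sup>2 * (m - 4) ^ (r - 1)))"
      by simp
    also have "\<dots> \<le> real (card (prime_holes (grid m) k))"
      using card_prime_holes_ge[OF mk(3), of m] unfolding r_def by (intro of_nat_mono)
    finally show ?thesis
      using pow unfolding r_def by simp
  qed
  show "\<forall>\<^sub>F n in sequentially. \<forall>m k. 0 < m \<and> n = m\<^sup>2 \<and> 3 \<le> k \<and> real k \<le> c * (2 * sqrt (real n))
      \<longrightarrow> (1 - c) * exp (- 8) * real n powr (real (k div 2) / 2 + 1)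
        \<le> real (card (prime_holes (grid m) k))"
    using eventually_ge_at_top[of 64] by eventually_elim (use main in blast)
qed

end
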